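(* Let $n\ge2$, let $G$ be the group generated by the transformations $s_0,s_1,s_2$ defined in the context, and let $H$ be the subgroup of $G$ generated by $s_0$ and $s_2$. Then a complete set of representatives of the double cosets $H\backslash G/H$ (one for each double coset) is given by the eight elements $$\mathrm{id},\quad s_1,\quad s_1s_2s_1,\quad s_1s_0s_1,\quad s_1s_0s_2s_1,\quad s_1s_2s_1s_0s_1,\quad s_1s_0s_1s_2s_1,\quad s_1s_0s_2s_1s_0s_2s_1 .$$
   Context: Fix $m=(m_1,\dots,m_n)\in\mathbb{N}^n$ and $|M|=m_1+\cdots+m_n$. The transformations act on pairs $(\vec v,x)$ with $\vec v={}^t[a_1,a_2,c,d,e_1,e_2]\in\mathbb{C}^6$, $x=(x_1,\dots,x_n)\in\mathbb{C}^n$: $s_0$ exchanges $a_1$ and $a_2$ and fixes everything else; $s_2$ exchanges $e_1$ and $e_2$ and fixes everything else; $s_1$ sends $(a_1,a_2,c,d,e_1,e_2)$ to $(a_1,\ e_1-a_2,\ e_1-c,\ e_1+e_2-a_2-c,\ e_1,\ e_1+d-a_2-c)$ and $x_i$ to $-m_i+|M|-x_i$ for $1\le i\le n$. The group operation is composition. *)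

theory Defs
  imports "HOL-Analysis.Cartesian_Space" "HOL-Algebra.Bij" "HOL-Algebra.Generated_Groups"
begin

text \<open>
  A point \<open>(v, x)\<close> consists of \<open>v = [a\<^sub>1, a\<^sub>2, c, d, e\<^sub>1, e\<^sub>2]\<close>, stored in the
  components \<open>v $ 1, \<dots>, v $ 6\<close>, and of \<open>x \<in> \<complex>\<^sup>n\<close> with \<open>n = CARD('n)\<close>.
\<close>

type_synonym 'n point = "(complex ^ 6) \<times> (complex ^ 'n)"

definition s0 :: "'n::finite point \<Rightarrow> 'n point" where
  "s0 = (\<lambda>(v, x). (vector [v $ 2, v $ 1, v $ 3, v $ 4, v $ 5, v $ 6], x))"

definition s2 :: "'n::finite point \<Rightarrow> 'n point" where
  "s2 = (\<lambda>(v, x). (vector [v $ 1, v $ 2, v $ 3, v $ 4, v $ 6, v $ 5], x))"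

definition s1 :: "nat ^ 'n::finite \<Rightarrow> 'n point \<Rightarrow> 'n point" where
  "s1 m = (\<lambda>(v, x).
     let a1 = v $ 1; a2 = v $ 2; c = v $ 3; d = v $ 4; e1 = v $ 5; e2 = v $ 6
     in (vector [a1, e1 - a2, e1 - c, e1 + e2 - a2 - c, e1, e1 + d - a2 - c],
         \<chi> i. - of_nat (m $ i) + of_nat (\<Sum>j\<in>UNIV. m $ j) - x $ i))"

text \<open>
  All groups live inside \<open>BijGroup UNIV\<close>, whose multiplication \<open>compose UNIV\<close> is
  ordinary composition of functions.
\<close>

definition G :: "nat ^ 'n::finite \<Rightarrow> ('n point \<Rightarrow> 'n point) monoid" where
  "G m = (BijGroup UNIV)\<lparr>carrier := generate (BijGroup UNIV) {s0, s1 m, s2}\<rparr>"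

definition H :: "nat ^ 'n::finite \<Rightarrow> ('n point \<Rightarrow> 'n point) set" where
  "H m = generate (G m) {s0, s2}"

definition double_coset :: "('a, 'b) monoid_scheme \<Rightarrow> 'a set \<Rightarrow> 'a \<Rightarrow> 'a set \<Rightarrow> 'a set" where
  "double_coset \<Gamma> A g B = (A #>\<^bsub>\<Gamma>\<^esub> g) <#>\<^bsub>\<Gamma>\<^esub> B"

definition double_cosets :: "('a, 'b) monoid_scheme \<Rightarrow> 'a set \<Rightarrow> 'a set \<Rightarrow> 'a set set" where
  "double_cosets \<Gamma> A B = (\<lambda>g. double_coset \<Gamma> A g B) ` carrier \<Gamma>"

text \<open>
  A list of representatives: every entry lies in the group, and every double coset
  contains the entry at exactly one position of the list (so there are no repetitions).
\<close>

definition double_coset_representatives ::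
  "('a, 'b) monoid_scheme \<Rightarrow> 'a set \<Rightarrow> 'a set \<Rightarrow> 'a list \<Rightarrow> bool" where
  "double_coset_representatives \<Gamma> A B rs \<longleftrightarrow>
     set rs \<subseteq> carrier \<Gamma> \<and>
     (\<forall>D \<in> double_cosets \<Gamma> A B. \<exists>!i. i < length rs \<and> rs ! i \<in> D)"

lemma UNIV_6: "(UNIV :: 6 set) = {1, 2, 3, 4, 5, 6}"
proof -
  have "card {1, 2, 3, 4, 5, 6 :: 6} = 6" by simp
  then show ?thesis by (intro sym[OF card_subset_eq]) auto
qed

lemma forall_6: "(\<forall>i::6. P i) \<longleftrightarrow> P 1 \<and> P 2 \<and> P 3 \<and> P 4 \<and> P 5 \<and> P 6"
proof -
  have "(\<forall>i::6. P i) \<longleftrightarrow> (\<forall>i \<in> {1, 2, 3, 4, 5, 6 :: 6}. P i)"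
    by (simp only: UNIV_6[symmetric] ball_UNIV)
  then show ?thesis by simp
qed

lemma distinct_6:
  "(1::6) \<noteq> 2" "(1::6) \<noteq> 3" "(1::6) \<noteq> 4" "(1::6) \<noteq> 5" "(1::6) \<noteq> 6"
  "(2::6) \<noteq> 3" "(2::6) \<noteq> 4" "(2::6) \<noteq> 5" "(2::6) \<noteq> 6"
  "(3::6) \<noteq> 4" "(3::6) \<noteq> 5" "(3::6) \<noteq> 6"
  "(4::6) \<noteq> 5" "(4::6) \<noteq> 6" "(5::6) \<noteq> 6"
  by simp_all

lemma vector_6_eq: "vector [a, b, c, d, e, f] =
    (\<chi> i::6. if i = 1 then a else if i = 2 then b else if i = 3 then c else
          if i = 4 then d else if i = 5 then e else if i = 6 then f else 0)"
proof -
  have "(1::6)+1 = 2" "(2::6)+1 = 3" "(3::6)+1 = 4" "(4::6)+1 = 5" "(5::6)+1 = 6" by simp_all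
  then show ?thesis
    unfolding vector_def list.simps foldr.simps o_apply fun_upd_def id_apply by (simp only:)
qed

lemma vector_6 [simp]:
  "(vector [a, b, c, d, e, f] :: ('a::zero) ^ 6) $ 1 = a"
  "(vector [a, b, c, d, e, f] :: ('a::zero) ^ 6) $ 2 = b"
  "(vector [a, b, c, d, e, f] :: ('a::zero) ^ 6) $ 3 = c"
  "(vector [a, b, c, d, e, f] :: ('a::zero) ^ 6) $ 4 = d"
  "(vector [a, b, c, d, e, f] :: ('a::zero) ^ 6) $ 5 = e"
  "(vector [a, b, c, d, e, f] :: ('a::zero) ^ 6) $ 6 = f"
  unfolding vector_6_eq by (simp_all only: vec_lambda_beta distinct_6[symmetric] if_False if_True simp_thms)

lemma s0_involution: "s0 \<circ> s0 = id"
  by (rule ext) (simp only: s0_def o_apply split_beta fst_conv snd_conv vector_6 prod_eq_iff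
      id_apply vec_eq_iff forall_6 simp_thms)

lemma s2_involution: "s2 \<circ> s2 = id"
  by (rule ext) (simp only: s2_def o_apply split_beta fst_conv snd_conv vector_6 prod_eq_iff
      id_apply vec_eq_iff forall_6 simp_thms)

lemma s1_involution: "s1 m \<circ> s1 m = id"
  by (rule ext) (simp only: s1_def Let_def o_apply split_beta fst_conv snd_conv vector_6
      prod_eq_iff id_apply vec_eq_iff forall_6 vec_lambda_beta, simp)

lemma generators_in_BijGroup: "{s0, s1 m, s2} \<subseteq> carrier (BijGroup UNIV)"
  using o_bij[OF s0_involution s0_involution] o_bij[OF s1_involution s1_involution, of m]
    o_bij[OF s2_involution s2_involution]
  by (simp add: BijGroup_def Bij_def)

lemma carrier_G_subset: "carrier (G m) \<subseteq> Bij UNIV"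
  using group.generate_incl[OF group_BijGroup generators_in_BijGroup[of m]]
  by (simp only: G_def BijGroup_def partial_object.simps)

lemma mult_G: "f \<otimes>\<^bsub>G m\<^esub> g = f \<circ> g" if "f \<in> carrier (G m)" "g \<in> carrier (G m)"
proof -
  have "f \<in> Bij UNIV" "g \<in> Bij UNIV"
    using that carrier_G_subset by blast+
  then have "f \<otimes>\<^bsub>BijGroup UNIV\<^esub> g = f \<circ> g"
    by (simp add: BijGroup_def compose_def fun_eq_iff)
  then show ?thesis
    by (simp add: G_def)
qed

end

theory Submission
  imports Defs
begin

text \<open>
  The group is the wreath product of the symmetric group on three letters with a group of
  order two, in disguise. The linear forms
  \<open>A0 = e\<^sub>1 + e\<^sub>2 - a\<^sub>1 - a\<^sub>2 - c\<close>, \<open>A1 = e\<^sub>1 - c\<close>, \<open>A2 = e\<^sub>2 - c\<close>,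
  \<open>B0 = c\<close>, \<open>B1 = d - a\<^sub>1\<close>, \<open>B2 = d - a\<^sub>2\<close>
  are coordinates on \<open>\<complex>\<^sup>6\<close>, and the generators permute them:
  \<open>s\<^sub>0 = (B1 B2)\<close>, \<open>s\<^sub>2 = (A1 A2)\<close>, \<open>s\<^sub>1 = (A0 B1)(A1 B0)(A2 B2)\<close>.
  Every element of the group keeps or exchanges the two blocks \<open>{A0, A1, A2}\<close> and
  \<open>{B0, B1, B2}\<close>, and it acts on \<open>x\<close> by the identity in the first case and by the reflection
  occurring in \<open>s\<^sub>1\<close> in the second. Hence an element is the same thing as its permutation
  of the six coordinates (\<open>permutes_coords_determines_map\<close>, \<open>permutes_coords_unique\<close>).

  The subgroup \<open>H\<close>, generated by the two disjoint transpositions, is the stabilizer of the pair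
  \<open>(A0, B0)\<close> (\<open>stabilizer_in_H\<close>). So cosets of \<open>H\<close> correspond to images of that pair, and
  double cosets to \<open>H\<close>-orbits of images (\<open>in_double_coset_iff_key\<close>). An image consists of one
  coordinate from each block, in either order, and \<open>H\<close> acts independently on the blocks, with two
  orbits on each, \<open>{A0}\<close>, \<open>{A1, A2}\<close> and \<open>{B0}\<close>, \<open>{B1, B2}\<close>. This leaves 2 * 2 * 2 = 8
  double cosets (\<open>key_cases\<close>), and following \<open>A0\<close> and \<open>B0\<close> through the eight words
  shows that each of them is met once.
\<close>

section \<open>Groups of bijections generated by involutions\<close>

lemma compose_in_generate:
  assumes "S \<subseteq> Bij UNIV" "f \<in> generate (BijGroup UNIV) S" "g \<in> generate (BijGroup UNIV) S"
  shows "f \<circ> g \<in> generate (BijGroup UNIV) S"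
proof -
  have "generate (BijGroup UNIV) S \<subseteq> Bij UNIV"
    using group.generate_incl[OF group_BijGroup, of S UNIV] assms(1) by (simp add: BijGroup_def)
  then have "f \<otimes>\<^bsub>BijGroup UNIV\<^esub> g = f \<circ> g"
    using assms by (auto simp: BijGroup_def compose_def fun_eq_iff)
  then show ?thesis
    using generate.eng[OF assms(2,3)] by simp
qed

lemma id_in_generate: "id \<in> generate (BijGroup UNIV) S"
  using generate.one[of "BijGroup UNIV" S] by (simp add: BijGroup_def restrict_def id_def)

text \<open>
  For involutive generators the inverses admitted by \<open>generate\<close> are generators again, so a
  property that is closed under composition needs no separate treatment of inverses.
\<close>
lemma generate_involutions_induct [consumes 2, case_names involution id gen comp]:
  assumes "g \<in> generate (BijGroup UNIV) S" "S \<subseteq> Bij UNIV"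
    and invol: "\<And>f. f \<in> S \<Longrightarrow> f \<circ> f = id"
    and "P id" "\<And>f. f \<in> S \<Longrightarrow> P f" "\<And>f g. P f \<Longrightarrow> P g \<Longrightarrow> P (f \<circ> g)"
  shows "P g"
proof -
  interpret group "BijGroup UNIV" by (rule group_BijGroup)
  have bij: "generate (BijGroup UNIV) S \<subseteq> Bij UNIV"
    using generate_incl[of S] assms(2) by (simp add: BijGroup_def)
  have mult: "f \<otimes>\<^bsub>BijGroup UNIV\<^esub> h = f \<circ> h" if "f \<in> Bij UNIV" "h \<in> Bij UNIV" for f h :: "'a \<Rightarrow> 'a"
    using that by (auto simp: BijGroup_def compose_def fun_eq_iff)
  have one: "\<one>\<^bsub>BijGroup UNIV\<^esub> = (id :: 'a \<Rightarrow> 'a)"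
    by (simp add: BijGroup_def restrict_def id_def)
  show ?thesis
    using assms(1)
  proof (induction rule: generate.induct)
    case one
    show ?case unfolding \<open>\<one>\<^bsub>BijGroup UNIV\<^esub> = id\<close> by (rule \<open>P id\<close>)
  next
    case (incl h)
    then show ?case by fact
  next
    case (inv h)
    then have "h \<in> carrier (BijGroup UNIV)" "h \<otimes>\<^bsub>BijGroup UNIV\<^esub> h = \<one>\<^bsub>BijGroup UNIV\<^esub>"
      using assms(2) invol[of h] mult[of h h] one by (auto simp: BijGroup_def)
    then have "inv\<^bsub>BijGroup UNIV\<^esub> h = h" by (simp add: inv_equality)
    then show ?case using inv assms(5) by simp
  next
    case (eng f h)
    then have "f \<in> Bij UNIV" "h \<in> Bij UNIV" using bij by auto
    then show ?case unfolding mult[OF \<open>f \<in> Bij UNIV\<close> \<open>h \<in> Bij UNIV\<close>] by (intro assms(6) eng)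
  qed
qed

lemma carrier_G: "carrier (G m) = generate (BijGroup UNIV) {s0, s1 m, s2}"
  by (simp add: G_def)

lemma H_eq: "H m = generate (BijGroup UNIV) {s0, s2}"
  unfolding H_def G_def
proof (rule group.generate_consistent[OF group_BijGroup])
  show "{s0, s2} \<subseteq> generate (BijGroup UNIV) {s0, s1 m, s2}"
    by (auto intro: generate.incl)
  show "subgroup (generate (BijGroup UNIV) {s0, s1 m, s2}) (BijGroup UNIV)"
    by (rule group.generate_is_subgroup[OF group_BijGroup generators_in_BijGroup])
qed

lemma generators_Bij: "{s0, s1 m, s2} \<subseteq> Bij UNIV"
  using generators_in_BijGroup[of m] by (simp add: BijGroup_def)

lemma H_subset_G: "H m \<subseteq> carrier (G m)"
  unfolding H_eq carrier_G
  by (rule group.mono_generate[OF group_BijGroup]) auto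

lemma double_coset_H:
  assumes "g \<in> carrier (G m)"
  shows "double_coset (G m) (H m) g (H m) = {h \<circ> g \<circ> k | h k. h \<in> H m \<and> k \<in> H m}"
proof -
  have G_comp: "f \<circ> f' \<in> carrier (G m)" if "f \<in> carrier (G m)" "f' \<in> carrier (G m)" for f f'
    using that compose_in_generate[OF generators_Bij[of m]] by (simp add: carrier_G)
  have prod: "h \<otimes>\<^bsub>G m\<^esub> g \<otimes>\<^bsub>G m\<^esub> k = h \<circ> g \<circ> k" if "h \<in> H m" "k \<in> H m" for h k
  proof -
    have "h \<in> carrier (G m)" "k \<in> carrier (G m)" using that H_subset_G by blast+
    then show ?thesis
      using assms by (simp only: mult_G G_comp)
  qed
  have "double_coset (G m) (H m) g (H m) =
      (\<Union>h \<in> H m. \<Union>k \<in> H m. {h \<otimes>\<^bsub>G m\<^esub> g \<otimes>\<^bsub>G m\<^esub> k})"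
    unfolding double_coset_def set_mult_def r_coset_def by simp
  also have "\<dots> = (\<Union>h \<in> H m. \<Union>k \<in> H m. {h \<circ> g \<circ> k})"
    by (intro SUP_cong refl) (simp only: prod)
  finally show ?thesis by blast
qed

section \<open>Six coordinates permuted by the group\<close>

datatype slot = A0 | A1 | A2 | B0 | B1 | B2

fun in_A :: "slot \<Rightarrow> bool" where
  "in_A A0 = True" | "in_A A1 = True" | "in_A A2 = True"
| "in_A B0 = False" | "in_A B1 = False" | "in_A B2 = False"

fun coord :: "slot \<Rightarrow> complex ^ 6 \<Rightarrow> complex" where
  "coord A0 v = v $ 5 + v $ 6 - v $ 1 - v $ 2 - v $ 3"
| "coord A1 v = v $ 5 - v $ 3"
| "coord A2 v = v $ 6 - v $ 3"
| "coord B0 v = v $ 3"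
| "coord B1 v = v $ 4 - v $ 1"
| "coord B2 v = v $ 4 - v $ 2"

lemma all_slot: "(\<forall>i. P i) \<longleftrightarrow> P A0 \<and> P A1 \<and> P A2 \<and> P B0 \<and> P B1 \<and> P B2"
  by (metis slot.exhaust)

text \<open>
  The forms \<open>B0\<close>, \<open>A1\<close>, \<open>A2\<close> give \<open>c\<close>, \<open>e\<^sub>1\<close>, \<open>e\<^sub>2\<close>; then \<open>A0\<close> gives
  \<open>a\<^sub>1 + a\<^sub>2\<close> and \<open>B1\<close>, \<open>B2\<close> give \<open>a\<^sub>1 - a\<^sub>2\<close>, which determines the rest.
\<close>
lemma coord_inject:
  assumes "\<And>i. coord i v = coord i w"
  shows "v = w"
proof -
  have e: "v $ 5 + v $ 6 - v $ 1 - v $ 2 - v $ 3 = w $ 5 + w $ 6 - w $ 1 - w $ 2 - w $ 3"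
    "v $ 5 - v $ 3 = w $ 5 - w $ 3" "v $ 6 - v $ 3 = w $ 6 - w $ 3" "v $ 3 = w $ 3"
    "v $ 4 - v $ 1 = w $ 4 - w $ 1" "v $ 4 - v $ 2 = w $ 4 - w $ 2"
    using assms[of A0] assms[of A1] assms[of A2] assms[of B0] assms[of B1] assms[of B2]
    by (simp_all only: coord.simps)
  have 356: "v $ 3 = w $ 3" "v $ 5 = w $ 5" "v $ 6 = w $ 6" using e(2-4) by simp_all
  have "v $ 1 + v $ 2 = (v $ 5 + v $ 6 - v $ 3) - (v $ 5 + v $ 6 - v $ 1 - v $ 2 - v $ 3)"
    by simp
  also have "\<dots> = w $ 1 + w $ 2"
    unfolding e(1) unfolding 356 by simp
  finally have plus: "v $ 1 + v $ 2 = w $ 1 + w $ 2" .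
  have "v $ 1 - v $ 2 = (v $ 4 - v $ 2) - (v $ 4 - v $ 1)" by simp
  also have "\<dots> = w $ 1 - w $ 2" unfolding e(5,6) by simp
  finally have "(v $ 1 + v $ 2) + (v $ 1 - v $ 2) = (w $ 1 + w $ 2) + (w $ 1 - w $ 2)"
    using plus by simp
  then have 1: "v $ 1 = w $ 1" by simp
  then have "v $ 2 = w $ 2" "v $ 4 = w $ 4" using e(5) plus by simp_all
  with 1 356 show ?thesis by (simp only: vec_eq_iff forall_6 simp_thms)
qed

lemma coord_separates: "\<exists>v. \<forall>i j. coord i v = coord j v \<longrightarrow> i = j"
proof
  (* Here (A0, A1, A2, B0, B1, B2) takes the values (10, 6, 7, 0, 4, 3). *)
  show "\<forall>i j. coord i (vector [1, 2, 0, 5, 6, 7]) = coord j (vector [1, 2, 0, 5, 6, 7]) \<longrightarrow> i = j"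
    by (simp add: all_slot)
qed

definition blockwise :: "(slot \<Rightarrow> slot) \<Rightarrow> bool" where
  "blockwise \<sigma> \<longleftrightarrow> inj \<sigma> \<and> (\<forall>i j. in_A (\<sigma> i) = in_A (\<sigma> j) \<longleftrightarrow> in_A i = in_A j)"

definition reflect :: "nat ^ 'n \<Rightarrow> complex ^ 'n::finite \<Rightarrow> complex ^ 'n" where
  "reflect m x = (\<chi> i. - of_nat (m $ i) + of_nat (\<Sum>j\<in>UNIV. m $ j) - x $ i)"

text \<open>
  Coordinates are pulled back along \<open>g\<close>, so composition is reversed: \<open>g \<circ> h\<close> corresponds to
  \<open>\<tau> \<circ> \<sigma>\<close> when \<open>g\<close>, \<open>h\<close> correspond to \<open>\<sigma>\<close>, \<open>\<tau>\<close>. The action on \<open>x\<close> is tied to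
  whether \<open>\<sigma>\<close> exchanges the blocks, which can be read off from \<open>A0\<close>; this is what makes \<open>\<sigma>\<close>
  determine \<open>g\<close> completely.
\<close>

definition permutes_coords ::
  "nat ^ 'n::finite \<Rightarrow> ('n point \<Rightarrow> 'n point) \<Rightarrow> (slot \<Rightarrow> slot) \<Rightarrow> bool" where
  "permutes_coords m g \<sigma> \<longleftrightarrow> blockwise \<sigma> \<and>
     (\<forall>v x. (\<forall>i. coord i (fst (g (v, x))) = coord (\<sigma> i) v) \<and>
            snd (g (v, x)) = (if in_A (\<sigma> A0) then x else reflect m x))"

lemma blockwise_opposite:
  assumes "blockwise \<sigma>"
  shows "in_A (\<sigma> B0) \<noteq> in_A (\<sigma> A0)"
proof -
  have "in_A (\<sigma> B0) = in_A (\<sigma> A0) \<longleftrightarrow> in_A B0 = in_A A0"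
    using assms unfolding blockwise_def by blast
  then show ?thesis by simp
qed

lemma reflect_reflect [simp]: "reflect m (reflect m x) = x"
  by (simp add: reflect_def vec_eq_iff)

lemma blockwise_id: "blockwise id"
  by (simp add: blockwise_def)

lemma blockwise_comp: "blockwise \<sigma> \<Longrightarrow> blockwise \<tau> \<Longrightarrow> blockwise (\<tau> \<circ> \<sigma>)"
  by (simp add: blockwise_def inj_compose)

lemma permutes_coords_id: "permutes_coords m id id"
  by (simp add: permutes_coords_def blockwise_id)

text \<open>
  The reflection of \<open>x\<close> is an involution, and it is applied by the composite exactly when one but
  not both of the two permutations exchange the blocks.
\<close>
lemma permutes_coords_comp:
  assumes "permutes_coords m g \<sigma>" "permutes_coords m h \<tau>"
  shows "permutes_coords m (g \<circ> h) (\<tau> \<circ> \<sigma>)"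
proof -
  have b: "in_A (\<tau> (\<sigma> A0)) \<longleftrightarrow> in_A (\<tau> A0) = in_A (\<sigma> A0)"
    using assms(2) unfolding permutes_coords_def blockwise_def by (metis in_A.simps(1))
  show ?thesis
    unfolding permutes_coords_def
  proof (intro conjI allI)
    show "blockwise (\<tau> \<circ> \<sigma>)"
      using assms blockwise_comp unfolding permutes_coords_def by blast
    fix v x i
    obtain w y where wy: "h (v, x) = (w, y)" by fastforce
    have w: "coord i w = coord (\<tau> i) v" for i
      using assms(2) wy unfolding permutes_coords_def by (metis fst_conv)
    have y: "y = (if in_A (\<tau> A0) then x else reflect m x)"
      using assms(2) wy unfolding permutes_coords_def by (metis snd_conv)
    show "coord i (fst ((g \<circ> h) (v, x))) = coord ((\<tau> \<circ> \<sigma>) i) v"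
      using assms(1) w wy by (simp add: permutes_coords_def)
    show "snd ((g \<circ> h) (v, x)) = (if in_A ((\<tau> \<circ> \<sigma>) A0) then x else reflect m x)"
      using assms(1) wy y b by (simp add: permutes_coords_def)
  qed
qed

lemma permutes_coords_determines_map:
  fixes g h :: "'a::finite point \<Rightarrow> 'a point"
  assumes "permutes_coords m g \<sigma>" "permutes_coords m h \<sigma>"
  shows "g = h"
proof
  fix z :: "'a point"
  obtain v x where z: "z = (v, x)" by fastforce
  have "fst (g z) = fst (h z)"
    by (rule coord_inject) (use assms z in \<open>simp add: permutes_coords_def\<close>)
  moreover have "snd (g z) = snd (h z)"
    using assms z by (simp add: permutes_coords_def)
  ultimately show "g z = h z" by (simp add: prod_eq_iff)
qed

lemma permutes_coords_unique:
  assumes "permutes_coords m g \<sigma>" "permutes_coords m g \<tau>"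
  shows "\<sigma> = \<tau>"
  using assms coord_separates unfolding permutes_coords_def by (metis ext)

fun perm0 :: "slot \<Rightarrow> slot" where
  "perm0 B1 = B2" | "perm0 B2 = B1" | "perm0 i = i"

fun perm2 :: "slot \<Rightarrow> slot" where
  "perm2 A1 = A2" | "perm2 A2 = A1" | "perm2 i = i"

fun perm1 :: "slot \<Rightarrow> slot" where
  "perm1 A0 = B1" | "perm1 B1 = A0"
| "perm1 A1 = B0" | "perm1 B0 = A1"
| "perm1 A2 = B2" | "perm1 B2 = A2"

lemma blockwise_generators: "blockwise perm0" "blockwise perm1" "blockwise perm2"
  by (simp_all add: blockwise_def inj_def all_slot)

lemma permutes_coords_s0: "permutes_coords m s0 perm0"
  by (simp add: permutes_coords_def blockwise_generators all_slot s0_def)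

lemma permutes_coords_s2: "permutes_coords m s2 perm2"
  by (simp add: permutes_coords_def blockwise_generators all_slot s2_def)

lemma permutes_coords_s1: "permutes_coords m (s1 m) perm1"
  by (simp add: permutes_coords_def blockwise_generators all_slot s1_def reflect_def Let_def)

lemma permutes_coords_G:
  assumes "g \<in> carrier (G m)"
  shows "\<exists>\<sigma>. permutes_coords m g \<sigma>"
  using assms[unfolded carrier_G] generators_Bij[of m]
proof (induction rule: generate_involutions_induct)
  case (involution f)
  then show ?case using s0_involution s1_involution s2_involution by auto
next
  case id
  then show ?case using permutes_coords_id by blast
next
  case (gen f)
  then show ?case using permutes_coords_s0 permutes_coords_s1 permutes_coords_s2 by blast
next
  case (comp f g)
  then show ?case using permutes_coords_comp by blast
qed

section \<open>Double cosets as orbits of pairs of coordinates\<close>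

text \<open>
  Each orbit of \<open>H\<close> on the coordinates is represented by one of its members, so that lying in the
  same orbit becomes the equation \<open>orb i = orb j\<close>.
\<close>

fun orb :: "slot \<Rightarrow> slot" where
  "orb A2 = A1" | "orb B2 = B1" | "orb i = i"

lemma orb_perm0 [simp]: "orb (perm0 i) = orb i"
  by (cases i) simp_all

lemma orb_perm2 [simp]: "orb (perm2 i) = orb i"
  by (cases i) simp_all

lemma orb_eq_fixed: "orb i = A0 \<longleftrightarrow> i = A0" "orb i = B0 \<longleftrightarrow> i = B0"
  by (cases i; simp)+

lemma permutes_coords_H:
  assumes "h \<in> H m"
  shows "\<exists>\<tau>. permutes_coords m h \<tau> \<and> (\<forall>i. orb (\<tau> i) = orb i)"
proof -
  have "{s0, s2} \<subseteq> Bij UNIV" using generators_Bij[of undefined] by blast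
  with assms[unfolded H_eq] show ?thesis
  proof (induction rule: generate_involutions_induct)
    case (involution f)
    then show ?case using s0_involution s2_involution by auto
  next
    case id
    show ?case by (intro exI[of _ id] conjI permutes_coords_id) simp
  next
    case (gen f)
    have "\<exists>\<tau>. permutes_coords m s0 \<tau> \<and> (\<forall>i. orb (\<tau> i) = orb i)"
      by (intro exI[of _ perm0] conjI permutes_coords_s0) simp
    moreover have "\<exists>\<tau>. permutes_coords m s2 \<tau> \<and> (\<forall>i. orb (\<tau> i) = orb i)"
      by (intro exI[of _ perm2] conjI permutes_coords_s2) simp
    ultimately show ?case using gen by (elim insertE emptyE) simp_all
  next
    case (comp f g)
    then obtain \<sigma> \<tau> where "permutes_coords m f \<sigma>" "\<forall>i. orb (\<sigma> i) = orb i"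
      "permutes_coords m g \<tau>" "\<forall>i. orb (\<tau> i) = orb i" by blast
    then have "permutes_coords m (f \<circ> g) (\<tau> \<circ> \<sigma>)" "\<forall>i. orb ((\<tau> \<circ> \<sigma>) i) = orb i"
      by (simp_all only: permutes_coords_comp o_apply simp_thms)
    then show ?case by blast
  qed
qed

lemma H_members: "id \<in> H m" "s0 \<in> H m" "s2 \<in> H m"
  by (auto simp: H_eq id_in_generate intro: generate.incl)

lemma H_comp: "h \<in> H m \<Longrightarrow> k \<in> H m \<Longrightarrow> h \<circ> k \<in> H m"
  unfolding H_eq using compose_in_generate generators_Bij[of undefined] by blast

text \<open>
  A blockwise permutation fixing \<open>A0\<close> and \<open>B0\<close> preserves both blocks, so it can only permute
  \<open>A1\<close>, \<open>A2\<close> and permute \<open>B1\<close>, \<open>B2\<close>: one of the four products of \<open>s\<^sub>0\<close> and \<open>s\<^sub>2\<close>.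
\<close>
lemma stabilizer_in_H:
  assumes "blockwise \<eta>" "\<eta> A0 = A0" "\<eta> B0 = B0"
  shows "\<exists>h \<in> H m. permutes_coords m h \<eta>"
proof -
  have side: "in_A (\<eta> i) = in_A i" for i
    using assms(1,2) unfolding blockwise_def by (metis in_A.simps(1))
  have inj: "\<eta> i = \<eta> j \<longleftrightarrow> i = j" for i j
    using assms(1) unfolding blockwise_def by (metis injD)
  have A: "\<eta> A1 = A1 \<and> \<eta> A2 = A2 \<or> \<eta> A1 = A2 \<and> \<eta> A2 = A1"
    using side[of A1] side[of A2] inj[of A1 A0] inj[of A2 A0] inj[of A1 A2] assms(2)
    by (cases "\<eta> A1"; cases "\<eta> A2"; simp)
  have B: "\<eta> B1 = B1 \<and> \<eta> B2 = B2 \<or> \<eta> B1 = B2 \<and> \<eta> B2 = B1"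
    using side[of B1] side[of B2] inj[of B1 B0] inj[of B2 B0] inj[of B1 B2] assms(3)
    by (cases "\<eta> B1"; cases "\<eta> B2"; simp)
  have "\<eta> = id \<or> \<eta> = perm0 \<or> \<eta> = perm2 \<or> \<eta> = perm2 \<circ> perm0"
    using A B assms(2,3) by (simp add: fun_eq_iff all_slot) auto
  then show ?thesis
    using permutes_coords_id permutes_coords_s0 permutes_coords_s2
      permutes_coords_comp[OF permutes_coords_s0 permutes_coords_s2] H_members H_comp
    by metis
qed

text \<open>
  The element moving \<open>a\<close> to \<open>b\<close> can be chosen to leave the other block alone; two coordinates in
  opposite blocks can therefore be moved independently of each other.
\<close>
lemma H_transitive_on_orb:
  assumes "orb a = orb b"
  shows "\<exists>h \<in> H m. \<exists>\<tau>. permutes_coords m h \<tau> \<and> \<tau> a = b \<and> (\<forall>i. in_A i \<noteq> in_A a \<longrightarrow> \<tau> i = i)"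
proof -
  have "\<exists>\<tau> \<in> {id, perm0, perm2}. \<tau> a = b \<and> (\<forall>i. in_A i \<noteq> in_A a \<longrightarrow> \<tau> i = i)"
    using assms by (cases a; cases b; simp add: all_slot)
  then show ?thesis
    using permutes_coords_id permutes_coords_s0 permutes_coords_s2 H_members by blast
qed

text \<open>
  The \<open>H\<close>-orbit of the image of \<open>(A0, B0)\<close>. Recording the orbits of the two entries separately
  loses nothing, because the entries lie in opposite blocks.
\<close>

definition key :: "(slot \<Rightarrow> slot) \<Rightarrow> slot \<times> slot" where
  "key \<sigma> = (orb (\<sigma> A0), orb (\<sigma> B0))"

lemma blockwise_inv:
  assumes "blockwise \<sigma>"
  shows "bij \<sigma>" "blockwise (inv_into UNIV \<sigma>)"
proof -
  have "UNIV = {A0, A1, A2, B0, B1, B2}" using all_slot[of "\<lambda>i. i \<in> {A0, A1, A2, B0, B1, B2}"] by auto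
  then have "finite (UNIV :: slot set)" by (metis finite.emptyI finite_insert)
  then show "bij \<sigma>"
    using assms by (simp add: blockwise_def bij_def finite_UNIV_inj_surj)
  then show "blockwise (inv_into UNIV \<sigma>)"
    using assms unfolding blockwise_def by (metis bij_imp_bij_inv bij_is_inj bij_inv_eq_iff)
qed

text \<open>
  The key is constant on double cosets: the left factor pulls back first and fixes \<open>A0\<close> and
  \<open>B0\<close>, and the right factor only moves coordinates within their orbits. Conversely, if the keys
  agree, right multiplication by an element of \<open>H\<close> makes the images of \<open>A0\<close> and \<open>B0\<close> themselves
  agree, and two group elements with the same images differ by an element of the stabilizer of
  \<open>(A0, B0)\<close>, placed on the left.
\<close>
lemma in_double_coset_iff_key:
  assumes g: "g \<in> carrier (G m)" "permutes_coords m g \<sigma>" and r: "permutes_coords m r \<rho>"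
  shows "r \<in> double_coset (G m) (H m) g (H m) \<longleftrightarrow> key \<rho> = key \<sigma>"
proof
  assume "r \<in> double_coset (G m) (H m) g (H m)"
  then obtain h k where hk: "h \<in> H m" "k \<in> H m" and r_eq: "r = h \<circ> g \<circ> k"
    unfolding double_coset_H[OF g(1)] by blast
  obtain \<eta> where \<eta>: "permutes_coords m h \<eta>" "\<forall>i. orb (\<eta> i) = orb i"
    using permutes_coords_H[OF hk(1)] by blast
  obtain \<tau> where \<tau>: "permutes_coords m k \<tau>" "\<forall>i. orb (\<tau> i) = orb i"
    using permutes_coords_H[OF hk(2)] by blast
  have "\<eta> A0 = A0" "\<eta> B0 = B0"
    using \<eta>(2)[rule_format, of A0] \<eta>(2)[rule_format, of B0] by (simp_all add: orb_eq_fixed)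
  moreover have "\<rho> = \<tau> \<circ> (\<sigma> \<circ> \<eta>)"
    by (rule permutes_coords_unique[OF r])
      (simp only: r_eq permutes_coords_comp[OF permutes_coords_comp[OF \<eta>(1) g(2)] \<tau>(1)])
  ultimately show "key \<rho> = key \<sigma>"
    using \<tau>(2) by (simp add: key_def)
next
  assume "key \<rho> = key \<sigma>"
  then have orbs: "orb (\<sigma> A0) = orb (\<rho> A0)" "orb (\<sigma> B0) = orb (\<rho> B0)"
    by (simp_all add: key_def)
  have bl: "blockwise \<sigma>" "blockwise \<rho>"
    using g(2) r by (auto simp: permutes_coords_def)
  note opp = blockwise_opposite[OF bl(1)] blockwise_opposite[OF bl(2)]
  have orb_side: "in_A a = in_A b" if "orb a = orb b" for a b
    using that by (cases a; cases b; simp)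
  obtain h \<tau> where h: "h \<in> H m" "permutes_coords m h \<tau>"
    "\<tau> (\<sigma> A0) = \<rho> A0" "\<forall>i. in_A i \<noteq> in_A (\<sigma> A0) \<longrightarrow> \<tau> i = i"
    using H_transitive_on_orb[OF orbs(1)] by blast
  obtain k \<kappa> where k: "k \<in> H m" "permutes_coords m k \<kappa>"
    "\<kappa> (\<sigma> B0) = \<rho> B0" "\<forall>i. in_A i \<noteq> in_A (\<sigma> B0) \<longrightarrow> \<kappa> i = i"
    using H_transitive_on_orb[OF orbs(2)] by blast
  define \<pi> where "\<pi> = \<kappa> \<circ> \<tau> \<circ> \<sigma>"
  have \<pi>: "permutes_coords m (g \<circ> (h \<circ> k)) \<pi>"
    unfolding \<pi>_def by (intro permutes_coords_comp g h k)
  have "\<kappa> (\<rho> A0) = \<rho> A0" "\<tau> (\<sigma> B0) = \<sigma> B0"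
    using h(4) k(4) opp orb_side[OF orbs(2)] by blast+
  then have "\<pi> A0 = \<rho> A0" "\<pi> B0 = \<rho> B0"
    by (simp_all add: \<pi>_def h(3) k(3))
  moreover have "blockwise \<pi>" using \<pi> by (simp add: permutes_coords_def)
  note inv = blockwise_inv[OF this]
  ultimately have "(inv_into UNIV \<pi> \<circ> \<rho>) A0 = A0" "(inv_into UNIV \<pi> \<circ> \<rho>) B0 = B0"
    by (simp_all only: o_apply inv_f_f[OF bij_is_inj[OF inv(1)]] flip: \<open>\<pi> A0 = \<rho> A0\<close> \<open>\<pi> B0 = \<rho> B0\<close>)
  then obtain l where l: "l \<in> H m" "permutes_coords m l (inv_into UNIV \<pi> \<circ> \<rho>)"
    using stabilizer_in_H[OF blockwise_comp[OF bl(2) inv(2)]] by blast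
  have "\<pi> \<circ> (inv_into UNIV \<pi> \<circ> \<rho>) = \<rho>"
    using inv(1) by (simp add: fun_eq_iff bij_is_surj surj_f_inv_f)
  with permutes_coords_comp[OF l(2) \<pi>] have "permutes_coords m (l \<circ> (g \<circ> (h \<circ> k))) \<rho>"
    by (simp only:)
  then have "r = l \<circ> g \<circ> (h \<circ> k)"
    using permutes_coords_determines_map[OF r] by (simp only: o_assoc)
  then show "r \<in> double_coset (G m) (H m) g (H m)"
    unfolding double_coset_H[OF g(1)] using l(1) H_comp[OF h(1) k(1)] by blast
qed

lemma key_cases:
  assumes "blockwise \<sigma>"
  shows "key \<sigma> \<in> {A0, A1} \<times> {B0, B1} \<union> {B0, B1} \<times> {A0, A1}"
  using blockwise_opposite[OF assms] by (cases "\<sigma> A0"; cases "\<sigma> B0"; simp add: key_def)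

text \<open>
  Double cosets correspond to keys, so no two of the listed group elements need to be compared
  directly.
\<close>
lemma representatives_if_keys_enumerated:
  assumes "set rs \<subseteq> carrier (G m)" and perms: "list_all2 (permutes_coords m) rs ps"
    and keys: "distinct (map key ps)"
      "{A0, A1} \<times> {B0, B1} \<union> {B0, B1} \<times> {A0, A1} \<subseteq> set (map key ps)"
  shows "double_coset_representatives (G m) (H m) (H m) rs"
  unfolding double_coset_representatives_def
proof (intro conjI ballI)
  show "set rs \<subseteq> carrier (G m)" by fact
  fix D
  assume "D \<in> double_cosets (G m) (H m) (H m)"
  then obtain g where g: "g \<in> carrier (G m)" "D = double_coset (G m) (H m) g (H m)"
    by (auto simp: double_cosets_def)
  obtain \<sigma> where \<sigma>: "permutes_coords m g \<sigma>"
    using permutes_coords_G[OF g(1)] by blast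
  then have "blockwise \<sigma>" by (simp only: permutes_coords_def)
  then have "key \<sigma> \<in> set (map key ps)"
    by (rule subsetD[OF keys(2) key_cases])
  then have "\<exists>!i. i < length (map key ps) \<and> map key ps ! i = key \<sigma>"
    by (rule distinct_Ex1[OF keys(1)])
  moreover have "i < length rs \<and> rs ! i \<in> D \<longleftrightarrow> i < length (map key ps) \<and> map key ps ! i = key \<sigma>" for i
  proof (cases "i < length rs")
    case True
    then have "map key ps ! i = key (ps ! i)" "i < length ps"
      using list_all2_lengthD[OF perms] by simp_all
    then show ?thesis
      using True in_double_coset_iff_key[OF g(1) \<sigma> list_all2_nthD[OF perms True]]
      by (simp only: g(2) length_map simp_thms)
  next
    case False
    then show ?thesis
      using list_all2_lengthD[OF perms] by (simp only: length_map simp_thms)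
  qed
  ultimately show "\<exists>!i. i < length rs \<and> rs ! i \<in> D"
    by (simp only:)
qed

theorem mainTheorem3:
  fixes m :: "nat ^ 'n::finite"
  assumes "CARD('n) \<ge> 2"
  shows "double_coset_representatives (G m) (H m) (H m)
    [id,
     s1 m,
     s1 m \<circ> s2 \<circ> s1 m,
     s1 m \<circ> s0 \<circ> s1 m,
     s1 m \<circ> s0 \<circ> s2 \<circ> s1 m,
     s1 m \<circ> s2 \<circ> s1 m \<circ> s0 \<circ> s1 m,
     s1 m \<circ> s0 \<circ> s1 m \<circ> s2 \<circ> s1 m,
     s1 m \<circ> s0 \<circ> s2 \<circ> s1 m \<circ> s0 \<circ> s2 \<circ> s1 m]"
    (is "double_coset_representatives _ _ _ ?rs")
proof -
  (* Pulling back reverses the order of the letters in each word. *)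
  define ps where "ps =
    [id,
     perm1,
     perm1 \<circ> (perm2 \<circ> perm1),
     perm1 \<circ> (perm0 \<circ> perm1),
     perm1 \<circ> (perm2 \<circ> (perm0 \<circ> perm1)),
     perm1 \<circ> (perm0 \<circ> (perm1 \<circ> (perm2 \<circ> perm1))),
     perm1 \<circ> (perm2 \<circ> (perm1 \<circ> (perm0 \<circ> perm1))),
     perm1 \<circ> (perm2 \<circ> (perm0 \<circ> (perm1 \<circ> (perm2 \<circ> (perm0 \<circ> perm1)))))]"
  have perms: "list_all2 (permutes_coords m) ?rs ps"
    unfolding ps_def list_all2_Cons list_all2_Nil
    by (intro conjI TrueI refl permutes_coords_comp permutes_coords_id permutes_coords_s0 permutes_coords_s1
        permutes_coords_s2)
  have keys: "map key ps =
    [(A0, B0), (B1, A1), (A0, B1), (A1, B0), (A1, B1), (B1, A0), (B0, A1), (B0, A0)]"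
    by (simp add: ps_def key_def)
  have gens: "id \<in> carrier (G m)" "s0 \<in> carrier (G m)" "s1 m \<in> carrier (G m)" "s2 \<in> carrier (G m)"
    by (auto simp: carrier_G id_in_generate intro: generate.incl)
  have comp: "f \<circ> g \<in> carrier (G m)" if "f \<in> carrier (G m)" "g \<in> carrier (G m)" for f g
    using that compose_in_generate[OF generators_Bij[of m]] by (simp add: carrier_G)
  have "set ?rs \<subseteq> carrier (G m)"
    by (simp only: list.set insert_subset empty_subsetI gens comp simp_thms)
  then show ?thesis
    using perms by (rule representatives_if_keys_enumerated) (unfold keys, auto)
qed

end
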